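(* Let $\mathbf{s}=(s_i)_{i\geq1}$ be a sequence of positive integers and $n\geq 1$. The following are equivalent: (i) the cone $\mathcal{C}_n^{(\mathbf{s})}$ is Gorenstein; (ii) there exists $m\in\mathcal{L}_n^{(\mathbf{s})}$ such that, as rational functions, $g^{(\mathbf{s})}(1/x_1,\ldots,1/x_n)=\pm x_1^{m_1}\cdots x_n^{m_n}\, g^{(\mathbf{s})}(x_1,\ldots,x_n)$; (iii) $f_n^{(\mathbf{s})}(q)=\sum_{\lambda\in\mathcal{L}_n^{(\mathbf{s})}} q^{|\lambda|}$ is self-reciprocal.
   Context: $\mathcal{L}_n^{(\mathbf{s})}=\{\lambda\in\mathbb{Z}^n : 0\leq \lambda_1/s_1\leq\cdots\leq \lambda_n/s_n\}$, $|\lambda|=\lambda_1+\cdots+\lambda_n$, and $g^{(\mathbf{s})}(x_1,\ldots,x_n)=\sum_{\lambda\in\mathcal{L}_n^{(\mathbf{s})}} x_1^{\lambda_1}\cdots x_n^{\lambda_n}$. The $\mathbf{s}$-lecture hall cone is $\mathcal{C}_n^{(\mathbf{s})}=\{\lambda\in\mathbb{R}^n: 0\leq \lambda_1/s_1\leq\cdots\leq\lambda_n/s_n\}$. A pointed rational cone $\mathcal{C}\subset\mathbb{R}^n$ is Gorenstein if there is an integer point $\mathbf{c}$ in the interior $\mathcal{C}^\circ$ with $\mathcal{C}^\circ\cap\mathbb{Z}^n=\mathbf{c}+(\mathcal{C}\cap\mathbb{Z}^n)$ ($\mathbf{c}$ is called a Gorenstein point). A rational function $r(q)$ is self-reciprocal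 if $r(1/q)=\pm q^k r(q)$ for some nonnegative integer $k$. *)

theory Defs
  imports
    "HOL-Analysis.Analysis"
    "HOL-Library.Poly_Mapping"
    "HOL-Computational_Algebra.Fraction_Field"
begin

section \<open>Lecture hall cones and lecture hall partitions\<close>

text \<open>
  The space of real n-vectors is the library topology \<^const>\<open>Euclidean_space\<close>: functions on
  the natural numbers that vanish from position n on. Everything is therefore indexed from 0: the
  coordinates are at positions 0, ..., n - 1, and \<open>s i\<close> is the (i+1)-st term of the sequence.
\<close>

definition lecture_hall_cone :: "(nat \<Rightarrow> nat) \<Rightarrow> nat \<Rightarrow> (nat \<Rightarrow> real) set" where
  "lecture_hall_cone s n =
     {x \<in> topspace (Euclidean_space n).
        0 \<le> x 0 / real (s 0) \<and>
        (\<forall>i. Suc i < n \<longrightarrow> x i / real (s i) \<le> x (Suc i) / real (s (Suc i)))}"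

definition integer_points :: "nat \<Rightarrow> (nat \<Rightarrow> real) set" where
  "integer_points n = {x \<in> topspace (Euclidean_space n). \<forall>i. x i \<in> \<int>}"

text \<open>To be used for pointed rational cones, such as the lecture hall cones.\<close>

definition gorenstein_cone :: "nat \<Rightarrow> (nat \<Rightarrow> real) set \<Rightarrow> bool" where
  "gorenstein_cone n C \<longleftrightarrow>
     (\<exists>c \<in> (Euclidean_space n interior_of C) \<inter> integer_points n.
        (Euclidean_space n interior_of C) \<inter> integer_points n =
          (\<lambda>x i. c i + x i) ` (C \<inter> integer_points n))"

text \<open>
  Integer vectors are finitely supported functions, so that they serve as exponent vectors of
  monomials below.
\<close>

definition lecture_hall_partitions :: "(nat \<Rightarrow> nat) \<Rightarrow> nat \<Rightarrow> (nat \<Rightarrow>\<^sub>0 int) set" where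
  "lecture_hall_partitions s n =
     {l. (\<lambda>i. real_of_int (Poly_Mapping.lookup l i)) \<in> lecture_hall_cone s n}"

definition weight :: "nat \<Rightarrow> (nat \<Rightarrow>\<^sub>0 int) \<Rightarrow> int" where
  "weight n l = (\<Sum>i<n. Poly_Mapping.lookup l i)"

section \<open>Rational functions\<close>

text \<open>
  For an ordered abelian group \<open>'a\<close> of exponents, \<open>'a \<Rightarrow>\<^sub>0 rat\<close> is the ring of Laurent
  polynomials and its field of fractions is the field of rational functions. Exponents in
  \<open>nat \<Rightarrow>\<^sub>0 int\<close> give rational functions in several variables, exponents in \<open>int\<close> those in one
  variable. The order on exponents only serves to make the ring an integral domain.
\<close>

type_synonym 'a ratfun = "('a \<Rightarrow>\<^sub>0 rat) fract"

definition monomial :: "'a::linordered_ab_group_add \<Rightarrow> 'a ratfun" where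
  "monomial e = Fract (Poly_Mapping.single e 1) 1"

lemma poly_mapping_single_induct [case_names zero single add]:
  fixes p :: "'a \<Rightarrow>\<^sub>0 'b::comm_monoid_add"
  assumes "P 0" "\<And>e c. P (Poly_Mapping.single e c)" "\<And>p q. P p \<Longrightarrow> P q \<Longrightarrow> P (p + q)"
  shows "P p"
proof (induction p rule: update_induct)
  case (update f a b)
  then have "Poly_Mapping.update a b f = f + Poly_Mapping.single a b"
    by (intro poly_mapping_eqI)
       (auto simp: lookup_add lookup_single lookup_update when_def in_keys_iff)
  then show ?case
    using update assms by simp
qed (rule assms(1))

subsection \<open>Inverting all variables\<close>

definition laurent_invert ::
    "('a::linordered_ab_group_add \<Rightarrow>\<^sub>0 rat) \<Rightarrow> ('a \<Rightarrow>\<^sub>0 rat)" where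
  "laurent_invert p = Poly_Mapping.map_key uminus p"

lemma lookup_laurent_invert:
  "Poly_Mapping.lookup (laurent_invert p) e = Poly_Mapping.lookup p (- e)"
  by (simp add: laurent_invert_def map_key.rep_eq)

lemma laurent_invert_invert: "laurent_invert (laurent_invert p) = p"
  by (rule poly_mapping_eqI) (simp add: lookup_laurent_invert)

lemma laurent_invert_0 [simp]: "laurent_invert 0 = 0"
  by (rule poly_mapping_eqI) (simp add: lookup_laurent_invert)

lemma laurent_invert_eq_0_iff [simp]: "laurent_invert p = 0 \<longleftrightarrow> p = 0"
  by (metis laurent_invert_0 laurent_invert_invert)

lemma laurent_invert_single:
  "laurent_invert (Poly_Mapping.single e c) = Poly_Mapping.single (- e) c"
  by (rule poly_mapping_eqI)
     (auto simp: lookup_laurent_invert lookup_single when_def)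

lemma laurent_invert_add: "laurent_invert (p + q) = laurent_invert p + laurent_invert q"
  by (rule poly_mapping_eqI) (simp add: lookup_laurent_invert lookup_add)

lemma laurent_invert_mult: "laurent_invert (p * q) = laurent_invert p * laurent_invert q"
proof (induction p rule: poly_mapping_single_induct)
  case (single e c)
  show ?case
    by (induction q rule: poly_mapping_single_induct)
       (simp_all add: laurent_invert_single mult_single laurent_invert_add ring_distribs)
qed (simp_all add: laurent_invert_add ring_distribs)

text \<open>The substitution of the inverse of each variable for that variable.\<close>

lift_definition invert_vars :: "'a::linordered_ab_group_add ratfun \<Rightarrow> 'a ratfun"
  is "\<lambda>(a, b). (laurent_invert a, laurent_invert b)"
  by (clarsimp simp flip: laurent_invert_mult)

lemma invert_vars_Fract:
  "b \<noteq> 0 \<Longrightarrow> invert_vars (Fract a b) = Fract (laurent_invert a) (laurent_invert b)"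
  by transfer simp

definition self_reciprocal :: "int ratfun \<Rightarrow> bool" where
  "self_reciprocal r \<longleftrightarrow>
     (\<exists>k::nat. invert_vars r = monomial (int k) * r \<or>
               invert_vars r = - (monomial (int k) * r))"

subsection \<open>Generating functions\<close>

text \<open>
  Formal series are given by their coefficients. The following is the coefficient function of the
  sum of the monomials with exponents \<open>w l\<close> for \<open>l \<in> L\<close>; it is meaningful if each exponent is
  attained only finitely often.
\<close>

definition gen_series :: "('b \<Rightarrow> 'a) \<Rightarrow> 'b set \<Rightarrow> 'a \<Rightarrow> rat" where
  "gen_series w L e = of_nat (card {l \<in> L. w l = e})"

definition series_mult ::
    "('a::linordered_ab_group_add \<Rightarrow>\<^sub>0 rat) \<Rightarrow> ('a \<Rightarrow> rat) \<Rightarrow> 'a \<Rightarrow> rat" where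
  "series_mult p F e =
     (\<Sum>d \<in> Poly_Mapping.keys p. Poly_Mapping.lookup p d * F (e - d))"

text \<open>
  The rational function \<open>r\<close> is the series \<open>F\<close>, i.e. \<open>r = a / b\<close> and \<open>b F = a\<close> as formal series.
  The lemma \<open>represents_unique\<close> shows that \<open>F\<close> determines \<open>r\<close>.
\<close>

definition represents :: "'a::linordered_ab_group_add ratfun \<Rightarrow> ('a \<Rightarrow> rat) \<Rightarrow> bool" where
  "represents r F \<longleftrightarrow>
     (\<exists>a b. b \<noteq> 0 \<and> r = Fract a b \<and> series_mult b F = Poly_Mapping.lookup a)"

lemma series_mult_superset:
  assumes "finite A" "Poly_Mapping.keys p \<subseteq> A"
  shows "series_mult p F e = (\<Sum>d \<in> A. Poly_Mapping.lookup p d * F (e - d))"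
  unfolding series_mult_def
  by (rule sum.mono_neutral_left) (use assms in \<open>auto simp: in_keys_iff\<close>)

lemma series_mult_add:
  "series_mult (p + q) F e = series_mult p F e + series_mult q F e"
proof -
  let ?A = "Poly_Mapping.keys p \<union> Poly_Mapping.keys q"
  have "Poly_Mapping.keys (p + q) \<subseteq> ?A"
    by (rule Poly_Mapping.keys_add)
  then show ?thesis
    by (simp add: series_mult_superset[where A = ?A] lookup_add ring_distribs sum.distrib)
qed

lemma series_mult_single:
  "series_mult (Poly_Mapping.single d c) F e = c * F (e - d)"
  by (simp add: series_mult_def)

lemma series_mult_lookup:
  "series_mult p (Poly_Mapping.lookup q) = Poly_Mapping.lookup (p * q)"
proof (induction p rule: poly_mapping_single_induct)
  case zero
  show ?case
    by (simp add: fun_eq_iff series_mult_def)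
next
  case (single d c)
  show ?case
  proof (induction q rule: poly_mapping_single_induct)
    case (single d' c')
    show ?case
      by (auto simp: fun_eq_iff series_mult_single mult_single lookup_single when_def)
  qed (simp_all add: fun_eq_iff series_mult_single lookup_add ring_distribs)
next
  case (add p1 p2)
  then show ?case
    by (simp add: fun_eq_iff series_mult_add lookup_add ring_distribs)
qed

lemma series_mult_commute:
  "series_mult p (series_mult q F) = series_mult q (series_mult p F)"
  unfolding series_mult_def fun_eq_iff sum_distrib_left
  by (subst sum.swap) (simp add: algebra_simps)

lemma represents_unique:
  assumes "represents r F" "represents r' F"
  shows "r = r'"
proof -
  obtain a b where ab: "b \<noteq> 0" "r = Fract a b" "series_mult b F = Poly_Mapping.lookup a"
    using assms(1) unfolding represents_def by blast
  obtain a' b' where ab': "b' \<noteq> 0" "r' = Fract a' b'"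
      "series_mult b' F = Poly_Mapping.lookup a'"
    using assms(2) unfolding represents_def by blast
  have "Poly_Mapping.lookup (b' * a) = series_mult b' (series_mult b F)"
    unfolding ab(3) series_mult_lookup ..
  also have "\<dots> = series_mult b (series_mult b' F)"
    by (rule series_mult_commute)
  also have "\<dots> = Poly_Mapping.lookup (b * a')"
    unfolding ab'(3) series_mult_lookup ..
  finally have "b' * a = b * a'"
    by (simp only: poly_mapping_eq_iff)
  then have "a * b' = a' * b"
    by (simp only: mult.commute)
  then show ?thesis
    unfolding ab(2) ab'(2) eq_fract(1)[OF ab(1) ab'(1)] .
qed

end

theory Submission
  imports Defs
begin

text \<open>
  The lecture hall cone is simplicial, with integral ray generators. For such a cone the generating
  function of the lattice points, with respect to any grading \<open>w\<close> with finite fibres, is a sum over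
  the half-open fundamental parallelepiped divided by \<open>\<Prod>j. 1 - x\<^bsup>w (v j)\<^esup>\<close>. The reflection
  \<open>x \<mapsto> (\<Sum>j. v j) - x\<close> exchanges the two half-open parallelepipeds, which yields Stanley
  reciprocity: inverting the variables gives, up to sign, the generating function of the open cone.
  Hence the functional equation with exponent \<open>m\<close> says that the open cone has as many points of
  degree \<open>e\<close> as the closed cone has of degree \<open>e - m\<close>. At \<open>e = m\<close> this gives an interior point
  \<open>c\<close> of degree \<open>m\<close>, and as the translate of the closed cone by \<open>c\<close> lies in the open cone, the count
  forces equality, i.e. \<open>c\<close> is a Gorenstein point. The trivial grading \<open>w l = l\<close> and the grading by weight give
  the multivariate and the univariate statement.
\<close>

section \<open>Series and Laurent polynomials\<close>

text \<open>With \<open>series_mult_1\<close> and \<open>series_mult_add\<close>, this makes series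
  a module over the Laurent polynomials, so that a product of factors can be applied one factor at a
  time.\<close>

lemma series_mult_mult: "series_mult (p * q) F = series_mult p (series_mult q F)"
proof (induction p rule: poly_mapping_single_induct)
  case zero
  show ?case by (simp add: fun_eq_iff series_mult_def)
next
  case (single d c)
  show ?case
  proof (induction q rule: poly_mapping_single_induct)
    case zero
    show ?case by (simp add: fun_eq_iff series_mult_def)
  next
    case (single d' c')
    show ?case by (simp add: fun_eq_iff mult_single series_mult_single algebra_simps)
  next
    case (add p q)
    then show ?case by (simp add: fun_eq_iff ring_distribs series_mult_add series_mult_single)
  qed
next
  case (add p1 p2)
  then show ?case by (simp add: fun_eq_iff ring_distribs series_mult_add)
qed

lemma series_mult_1: "series_mult 1 F = F"
  by (simp add: fun_eq_iff series_mult_single flip: single_one)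

lemma lookup_sum_single:
  assumes "finite S"
  shows "Poly_Mapping.lookup (\<Sum>x\<in>S. Poly_Mapping.single (w x) 1) = gen_series w S"
proof
  fix e
  have "Poly_Mapping.lookup (\<Sum>x\<in>S. Poly_Mapping.single (w x) 1) e
      = (\<Sum>x\<in>S. if w x = e then 1 else (0::rat))"
    by (simp add: lookup_sum lookup_single when_def)
  also have "\<dots> = gen_series w S e"
    using assms by (simp add: gen_series_def sum.If_cases Int_def)
  finally show "Poly_Mapping.lookup (\<Sum>x\<in>S. Poly_Mapping.single (w x) 1) e = gen_series w S e" .
qed

abbreviation one_minus_monom :: "'a::linordered_ab_group_add \<Rightarrow> 'a \<Rightarrow>\<^sub>0 rat" where
  "one_minus_monom d \<equiv> 1 - Poly_Mapping.single d 1"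

lemma series_mult_one_minus_monom: "series_mult (one_minus_monom d) F e = F e - F (e - d)"
proof -
  have "series_mult (one_minus_monom d) F e
      = series_mult (Poly_Mapping.single 0 1 + Poly_Mapping.single d (- 1)) F e"
    by (simp add: single_uminus)
  then show ?thesis
    by (simp only: series_mult_add series_mult_single) simp
qed

lemma laurent_invert_1 [simp]: "laurent_invert 1 = 1"
  by (metis laurent_invert_single minus_zero single_one)

lemma laurent_invert_uminus: "laurent_invert (- p) = - laurent_invert p"
  by (rule poly_mapping_eqI) (simp add: lookup_laurent_invert)

lemma laurent_invert_sum: "laurent_invert (sum f A) = (\<Sum>x\<in>A. laurent_invert (f x))"
  by (induction A rule: infinite_finite_induct) (simp_all add: laurent_invert_add)

lemma laurent_invert_prod: "laurent_invert (prod f A) = (\<Prod>x\<in>A. laurent_invert (f x))"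
  by (induction A rule: infinite_finite_induct) (simp_all add: laurent_invert_mult)

text \<open>Each factor of the denominator contributes one sign here; these make up the
  \<open>(- 1) ^ n\<close> of reciprocity.\<close>

lemma laurent_invert_one_minus_monom:
  "laurent_invert (one_minus_monom d) = - (Poly_Mapping.single (- d) 1 * one_minus_monom d)"
proof -
  have "laurent_invert (one_minus_monom d) = laurent_invert (1 + - Poly_Mapping.single d 1)"
    by simp
  also have "\<dots> = 1 - Poly_Mapping.single (- d) 1"
    by (simp only: laurent_invert_add laurent_invert_uminus laurent_invert_single laurent_invert_1) simp
  also have "\<dots> = - (Poly_Mapping.single (- d) 1 * one_minus_monom d)"
    by (simp add: algebra_simps mult_single)
  finally show ?thesis .
qed

lemma one_minus_monom_nonzero: "d \<noteq> 0 \<Longrightarrow> one_minus_monom d \<noteq> 0"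
  by (metis lookup_single_eq lookup_single_not_eq right_minus_eq single_one zero_neq_one)

lemma prod_single:
  "(\<Prod>j\<in>A. Poly_Mapping.single (f j) 1) = Poly_Mapping.single (\<Sum>j\<in>A. f j) (1::rat)"
  by (induction A rule: infinite_finite_induct) (simp_all add: mult_single)

lemma Fract_uminus: "- Fract a b = Fract (- a) b"
  by simp

section \<open>Simplicial cones\<close>

text \<open>\<open>Z\<close> is the lattice, \<open>v\<close> the ray generators and
  \<open>coord\<close> the dual coordinates, which may be fractional on \<open>Z\<close>. Of the
  conditions on the grading \<open>w\<close>, \<open>w_v\<close> keeps the denominator nonzero and
  \<open>finite_fibre\<close> makes the coefficients finite counts; \<open>finite_box\<close> makes
  the numerators Laurent polynomials.\<close>

locale simplicial_cone =
  fixes Z :: "'b::ab_group_add set" and n :: nat and coord :: "nat \<Rightarrow> 'b \<Rightarrow> real"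
    and v :: "nat \<Rightarrow> 'b" and w :: "'b \<Rightarrow> 'a::linordered_ab_group_add"
  assumes zero_in: "0 \<in> Z"
    and diff_in: "x \<in> Z \<Longrightarrow> y \<in> Z \<Longrightarrow> x - y \<in> Z"
    and v_in: "j < n \<Longrightarrow> v j \<in> Z"
    and additive_coord: "Modules.additive (coord j)"
    and additive_w: "Modules.additive w"
    and coord_v: "j < n \<Longrightarrow> k < n \<Longrightarrow> coord j (v k) = (if j = k then 1 else 0)"
    and w_v: "j < n \<Longrightarrow> w (v j) \<noteq> 0"
    and finite_box: "finite {x \<in> Z. \<forall>j<n. 0 \<le> coord j x \<and> coord j x \<le> 1}"
    and finite_fibre: "finite {x \<in> Z. (\<forall>j<n. 0 \<le> coord j x) \<and> w x = e}"
begin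

lemmas coord_add = Modules.additive.add[OF additive_coord]
  and coord_diff = Modules.additive.diff[OF additive_coord]
  and coord_0 = Modules.additive.zero[OF additive_coord]
  and coord_sum = Modules.additive.sum[OF additive_coord]
  and w_add = Modules.additive.add[OF additive_w]
  and w_diff = Modules.additive.diff[OF additive_w]
  and w_0 = Modules.additive.zero[OF additive_w]
  and w_sum = Modules.additive.sum[OF additive_w]

lemma add_in: "x \<in> Z \<Longrightarrow> y \<in> Z \<Longrightarrow> x + y \<in> Z"
  by (metis diff_in diff_minus_eq_add diff_0 zero_in)

lemma sum_in: "(\<And>j. j \<in> A \<Longrightarrow> f j \<in> Z) \<Longrightarrow> sum f A \<in> Z"
  by (induction A rule: infinite_finite_induct) (auto simp: zero_in add_in)

section \<open>Generating functions of the closed and the open cone\<close>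

definition cone where "cone = {x \<in> Z. \<forall>j<n. 0 \<le> coord j x}"

definition open_cone where "open_cone = {x \<in> Z. \<forall>j<n. 0 < coord j x}"

text \<open>
  For \<open>P\<close> the predicate \<open>\<lambda>a. 0 \<le> a\<close> or \<open>\<lambda>a. 0 < a\<close>, the slabs interpolate between the closed or open
  cone (\<open>k = 0\<close>) and the half-open fundamental parallelepiped \<open>0 \<le> a < 1\<close> or \<open>0 < a \<le> 1\<close>
  (\<open>k = n\<close>). Each is obtained from the preceding one by removing its translate by \<open>v k\<close>.
\<close>

definition slab :: "(real \<Rightarrow> bool) \<Rightarrow> nat \<Rightarrow> 'b set" where
  "slab P k = {x \<in> Z. \<forall>j<n. P (coord j x) \<and> (j < k \<longrightarrow> \<not> P (coord j x - 1))}"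

definition den :: "'a \<Rightarrow>\<^sub>0 rat" where "den = (\<Prod>j<n. one_minus_monom (w (v j)))"

definition num :: "(real \<Rightarrow> bool) \<Rightarrow> 'a \<Rightarrow>\<^sub>0 rat" where
  "num P = (\<Sum>x\<in>slab P n. Poly_Mapping.single (w x) 1)"

text \<open>Adding \<open>v k\<close> raises coordinate \<open>k\<close> by 1 and fixes the others,
  so the translate of \<open>slab P k\<close> is its part \<open>?T\<close> where
  \<open>P (coord k x - 1)\<close> holds. The factor subtracts the count of this part.\<close>

lemma slab_Suc:
  assumes k: "k < n" and P: "\<And>a. P a \<Longrightarrow> P (a + 1)" "\<And>a. P a \<Longrightarrow> 0 \<le> a"
  shows "series_mult (one_minus_monom (w (v k))) (gen_series w (slab P k)) = gen_series w (slab P (Suc k))"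
proof
  fix e
  let ?S = "{x \<in> slab P k. w x = e}"
  let ?T = "{x \<in> slab P k. w x = e \<and> P (coord k x - 1)}"
  have fin: "finite ?S"
    by (rule finite_subset[OF _ finite_fibre[of e]]) (use P(2) in \<open>auto simp: slab_def\<close>)
  have "bij_betw (\<lambda>x. x + v k) {x \<in> slab P k. w x = e - w (v k)} ?T"
  proof (rule bij_betwI[where g = "\<lambda>x. x - v k"])
    show "(\<lambda>x. x + v k) \<in> {x \<in> slab P k. w x = e - w (v k)} \<rightarrow> ?T"
      using k P(1) by (auto simp: slab_def coord_add coord_v w_add v_in add_in)
    show "(\<lambda>x. x - v k) \<in> ?T \<rightarrow> {x \<in> slab P k. w x = e - w (v k)}"
      using k by (auto simp: slab_def coord_diff coord_v w_diff v_in diff_in)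
  qed simp_all
  then have "card {x \<in> slab P k. w x = e - w (v k)} = card ?T"
    by (rule bij_betw_same_card)
  moreover have "{x \<in> slab P (Suc k). w x = e} = ?S - ?T"
    using k by (auto simp: slab_def less_Suc_eq)
  moreover have "?T \<subseteq> ?S" by blast
  then have "card (?S - ?T) = card ?S - card ?T" "card ?T \<le> card ?S"
    using fin by (simp_all add: card_Diff_subset card_mono finite_subset)
  ultimately show "series_mult (one_minus_monom (w (v k))) (gen_series w (slab P k)) e
      = gen_series w (slab P (Suc k)) e"
    by (simp add: series_mult_one_minus_monom gen_series_def of_nat_diff)
qed

lemma series_mult_den_slab:
  assumes P: "\<And>a. P a \<Longrightarrow> P (a + 1)" "\<And>a. P a \<Longrightarrow> 0 \<le> a"
  shows "series_mult den (gen_series w (slab P 0)) = gen_series w (slab P n)"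
proof -
  have "series_mult (\<Prod>j<k. one_minus_monom (w (v j))) (gen_series w (slab P 0)) = gen_series w (slab P k)"
    if "k \<le> n" for k
    using that
  proof (induction k)
    case 0
    show ?case by (simp add: series_mult_1)
  next
    case (Suc k)
    then show ?case
      using slab_Suc[of k P] P by (simp add: mult.commute[of "prod _ _"] series_mult_mult)
  qed
  then show ?thesis unfolding den_def by simp
qed

lemma slab_closed: "slab (\<lambda>a. 0 \<le> a) 0 = cone"
  and slab_open: "slab (\<lambda>a. 0 < a) 0 = open_cone"
  by (auto simp: slab_def cone_def open_cone_def)

lemma finite_slab: "finite (slab (\<lambda>a. 0 \<le> a) n)" "finite (slab (\<lambda>a. 0 < a) n)"
  by (rule finite_subset[OF _ finite_box]; force simp: slab_def)+

lemma series_mult_den: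
  "series_mult den (gen_series w cone) = Poly_Mapping.lookup (num (\<lambda>a. 0 \<le> a))"
  "series_mult den (gen_series w open_cone) = Poly_Mapping.lookup (num (\<lambda>a. 0 < a))"
  unfolding num_def lookup_sum_single[OF finite_slab(1)] lookup_sum_single[OF finite_slab(2)]
    slab_closed[symmetric] slab_open[symmetric]
  by (rule series_mult_den_slab; simp)+

lemma den_nonzero: "den \<noteq> 0"
  unfolding den_def using w_v by (simp add: one_minus_monom_nonzero del: right_minus_eq)

section \<open>Stanley reciprocity\<close>

text \<open>The reflection in the sum \<open>V\<close> of the generators turns a coordinate
  \<open>a\<close> into \<open>1 - a\<close>, exchanging \<open>0 \<le> a < 1\<close> with
  \<open>0 < a \<le> 1\<close>, and a degree \<open>d\<close> into \<open>w V - d\<close>.\<close>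

lemma laurent_invert_num:
  "laurent_invert (num (\<lambda>a. 0 \<le> a))
     = Poly_Mapping.single (- (\<Sum>j<n. w (v j))) 1 * num (\<lambda>a. 0 < a)"
proof -
  define V where "V = (\<Sum>j<n. v j)"
  have V: "V \<in> Z" "coord j V = 1" if "j < n" for j
    using that by (auto simp: V_def coord_sum coord_v sum.delta intro!: sum_in v_in)
  \<comment> \<open>The preceding facts presuppose some \<open>j < n\<close>; this one also covers
    \<open>n = 0\<close>.\<close>
  have VZ: "V \<in> Z" by (auto simp: V_def intro!: sum_in v_in)
  have wV: "w V = (\<Sum>j<n. w (v j))" by (simp add: V_def w_sum)
  have "num (\<lambda>a. 0 < a) = (\<Sum>x\<in>slab (\<lambda>a. 0 \<le> a) n. Poly_Mapping.single (w (V - x)) 1)"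
    unfolding num_def
    by (rule sum.reindex_bij_witness[of _ "\<lambda>x. V - x" "\<lambda>x. V - x"])
       (use V VZ in \<open>auto simp: slab_def coord_diff diff_in\<close>)
  then show ?thesis
    by (simp add: num_def laurent_invert_sum laurent_invert_single sum_distrib_left mult_single w_diff wV)
qed

lemma laurent_invert_den:
  "laurent_invert den = (- 1) ^ n * (Poly_Mapping.single (- (\<Sum>j<n. w (v j))) 1 * den)"
proof -
  have "laurent_invert den
      = (\<Prod>j<n. (- 1) * (Poly_Mapping.single (- w (v j)) 1 * one_minus_monom (w (v j))))"
    unfolding den_def laurent_invert_prod laurent_invert_one_minus_monom by simp
  also have "\<dots> = (- 1) ^ n * (Poly_Mapping.single (- (\<Sum>j<n. w (v j))) 1 * den)"
    by (simp only: prod.distrib prod_single den_def prod_constant card_lessThan sum_negf)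
  finally show ?thesis .
qed

text \<open>Inversion produces the same monomial in the numerator and in the denominator; it cancels
  and leaves the sign \<open>(- 1) ^ n\<close>.\<close>

lemma reciprocity:
  "invert_vars (Fract (num (\<lambda>a. 0 \<le> a)) den) = Fract (num (\<lambda>a. 0 < a)) den \<or>
   invert_vars (Fract (num (\<lambda>a. 0 \<le> a)) den) = - Fract (num (\<lambda>a. 0 < a)) den"
proof -
  let ?X = "Poly_Mapping.single (- (\<Sum>j<n. w (v j))) (1::rat)"
  have X: "?X \<noteq> 0"
    by (metis lookup_single_eq lookup_zero zero_neq_one)
  show ?thesis
    using X den_nonzero
    by (cases "even n")
       (simp_all add: invert_vars_Fract laurent_invert_num laurent_invert_den eq_fract mult_ac)
qed

section \<open>Cancelling the denominator\<close>

text \<open>A point of degree \<open>e - k * w (v j)\<close>, moved \<open>k\<close> steps along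
  \<open>v j\<close>, lands in the finite fibre of degree \<open>e\<close>, where coordinate
  \<open>j\<close> is bounded. But that coordinate is now at least \<open>k\<close>.\<close>

lemma eventually_gen_series_eq_0:
  assumes "j < n" "S \<subseteq> cone"
    and closed: "\<And>x. x \<in> S \<Longrightarrow> x + v j \<in> S"
  shows "\<forall>\<^sub>F k in sequentially. gen_series w S (e - (\<Sum>i<k. w (v j))) = 0"
proof -
  let ?A = "{x \<in> S. w x = e}"
  have fin: "finite ?A"
    by (rule finite_subset[OF _ finite_fibre[of e]]) (use assms(2) in \<open>auto simp: cone_def\<close>)
  obtain K :: nat where K: "\<And>x. x \<in> ?A \<Longrightarrow> coord j x < K"
  proof -
    obtain K where "(\<Sum>x\<in>?A. coord j x) < of_nat K" using reals_Archimedean2 by blast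
    moreover have "coord j x \<le> (\<Sum>x\<in>?A. coord j x)" if "x \<in> ?A" for x
      by (rule member_le_sum) (use that fin assms in \<open>auto simp: cone_def\<close>)
    ultimately show ?thesis using that[of K] by fastforce
  qed
  have shift: "x + (\<Sum>i<k. v j) \<in> S" if "x \<in> S" for x and k :: nat
  proof (induction k)
    case (Suc k)
    then show ?case using closed[OF Suc] by (simp add: add.assoc)
  qed (use that in simp)
  have c: "coord j (\<Sum>i<k. v j) = k" "w (\<Sum>i<k. v j) = (\<Sum>i<k. w (v j))" for k :: nat
    using assms(1) by (simp_all add: coord_sum coord_v w_sum)
  have "gen_series w S (e - (\<Sum>i<k. w (v j))) = 0" if "k \<ge> K" for k :: nat
  proof -
    have False if x: "x \<in> S" "w x = e - (\<Sum>i<k. w (v j))" for x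
    proof -
      have "x + (\<Sum>i<k. v j) \<in> ?A" using shift[OF x(1)] x by (simp add: w_add c)
      from K[OF this] have "coord j x + k < K" by (simp add: coord_add c)
      moreover have "coord j x \<ge> 0" using x assms by (auto simp: cone_def)
      ultimately show False using \<open>k \<ge> K\<close> by simp
    qed
    then have E: "{x \<in> S. w x = e - (\<Sum>i<k. w (v j))} = {}" by blast
    show ?thesis unfolding gen_series_def E by simp
  qed
  then show ?thesis unfolding eventually_sequentially by blast
qed

text \<open>
  Multiplication by the denominator is injective only on series that vanish far down each ray:
  on such a series \<open>D e = D (e - w (v j))\<close> forces \<open>D = 0\<close>.
\<close>

lemma series_mult_den_eq_0:
  assumes ev: "\<And>j e. j < n \<Longrightarrow> \<forall>\<^sub>F k in sequentially. D (e - (\<Sum>i<k. w (v j))) = 0"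
    and 0: "series_mult den D = (\<lambda>_. 0)"
  shows "D = (\<lambda>_. 0)"
proof -
  \<comment> \<open>The induction hypothesis is applied to the last factor times \<open>D\<close>,
    so \<open>D\<close> must vary and its eventual vanishing must be carried along.\<close>
  have "D = (\<lambda>_. 0)" if "m \<le> n" "series_mult (\<Prod>j<m. one_minus_monom (w (v j))) D = (\<lambda>_. 0)"
    "\<And>j e. j < n \<Longrightarrow> \<forall>\<^sub>F k in sequentially. D (e - (\<Sum>i<k. w (v j))) = 0" for m D
    using that
  proof (induction m arbitrary: D)
    case 0
    then show ?case by (simp add: series_mult_1)
  next
    case (Suc m)
    let ?D = "series_mult (one_minus_monom (w (v m))) D"
    have "\<forall>\<^sub>F k in sequentially. ?D (e - (\<Sum>i<k. w (v j))) = 0" if "j < n" for j e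
      using Suc.prems(3)[OF that, of e] Suc.prems(3)[OF that, of "e - w (v m)"]
      by eventually_elim (simp add: series_mult_one_minus_monom cancel_ab_semigroup_add_class.diff_right_commute[of e "w (v m)"])
    moreover have "series_mult (\<Prod>j<m. one_minus_monom (w (v j))) ?D = (\<lambda>_. 0)"
      using Suc.prems(2) by (simp add: series_mult_mult)
    ultimately have "?D = (\<lambda>_. 0)"
      using Suc.IH Suc.prems(1) by simp
    then have D: "D (e - w (v m)) = D e" for e
      using series_mult_one_minus_monom[of "w (v m)" D e] by simp
    have "D (e - (\<Sum>i<k. w (v m))) = D e" for e and k :: nat
    proof (induction k)
      case (Suc k)
      have "D (e - (\<Sum>i<Suc k. w (v m))) = D (e - (\<Sum>i<k. w (v m)) - w (v m))"
        by (simp only: sum.lessThan_Suc diff_diff_eq)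
      then show ?case using D Suc by simp
    qed simp
    then have "D e = 0" for e
      using Suc.prems(1) Suc.prems(3)[of m e] by simp
    then show ?case by blast
  qed
  from this[OF order_refl] show ?thesis using assms unfolding den_def by blast
qed

section \<open>Functional equation and translates of the cone\<close>

text \<open>The origin has degree 0. This coefficient fixes the sign in the functional equation and
  yields the Gorenstein point.\<close>

lemma gen_series_cone_0_pos: "gen_series w cone 0 > 0"
proof -
  have "finite {x \<in> cone. w x = 0}"
    using finite_fibre[of 0] by (simp add: cone_def)
  moreover have "0 \<in> {x \<in> cone. w x = 0}"
    by (simp add: cone_def coord_0 w_0 zero_in)
  ultimately show ?thesis
    by (auto simp: gen_series_def card_gt_0_iff)
qed

text \<open>By reciprocity both sides are fractions over \<open>den\<close>, so the equation
  compares numerators up to sign. Cancelling \<open>den\<close> turns this into an equation of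
  series, in which the minus sign is impossible.\<close>

lemma functional_equation_iff:
  "(\<exists>g. represents g (gen_series w cone) \<and>
        (invert_vars g = monomial m * g \<or> invert_vars g = - (monomial m * g)))
   \<longleftrightarrow> (\<forall>e. gen_series w open_cone e = gen_series w cone (e - m))" (is "?L \<longleftrightarrow> ?R")
proof -
  let ?A = "num (\<lambda>a. 0 \<le> a)" and ?B = "num (\<lambda>a. 0 < a)" and ?X = "Poly_Mapping.single m (1::rat)"
  let ?F = "gen_series w cone" and ?G = "gen_series w open_cone"
  let ?g = "Fract ?A den"
  have rep: "represents ?g ?F"
    unfolding represents_def using den_nonzero series_mult_den(1) by blast
  have shift: "Poly_Mapping.lookup (?X * ?A) = series_mult den (\<lambda>e. ?F (e - m))"
  proof -
    have "series_mult den (series_mult ?X ?F) = Poly_Mapping.lookup (?X * ?A)"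
      by (simp only: series_mult_commute[of den] series_mult_den series_mult_lookup)
    then show ?thesis by (simp add: series_mult_single[abs_def])
  qed
  have mono: "monomial m * ?g = Fract (?X * ?A) den"
    by (simp add: monomial_def)
  have L: "?L \<longleftrightarrow> ?B = ?X * ?A \<or> ?B = - (?X * ?A)"
  proof -
    \<comment> \<open>The series determines the rational function, so \<open>?g\<close> is the only
      candidate.\<close>
    have "?L \<longleftrightarrow> invert_vars ?g = monomial m * ?g \<or> invert_vars ?g = - (monomial m * ?g)"
      using rep represents_unique by blast
    also have "\<dots> \<longleftrightarrow> Fract ?B den = Fract (?X * ?A) den \<or> Fract ?B den = - Fract (?X * ?A) den"
      using reciprocity unfolding mono by (metis minus_minus)
    also have "\<dots> \<longleftrightarrow> ?B = ?X * ?A \<or> ?B = - (?X * ?A)"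
      by (simp only: Fract_uminus eq_fract(1)[OF den_nonzero den_nonzero] mult_cancel_right
            den_nonzero simp_thms)
    finally show ?thesis .
  qed
  have evF: "\<forall>\<^sub>F k in sequentially. ?F (e - (\<Sum>i<k. w (v j))) = 0"
   and evG: "\<forall>\<^sub>F k in sequentially. ?G (e - (\<Sum>i<k. w (v j))) = 0" if "j < n" for j e
    by (rule eventually_gen_series_eq_0; use that in
        \<open>auto simp: cone_def open_cone_def coord_add coord_v add_in v_in
              intro: less_imp_le add_nonneg_nonneg\<close>)+
  show ?thesis
  proof
    assume ?R
    then have "Poly_Mapping.lookup ?B = Poly_Mapping.lookup (?X * ?A)"
      unfolding shift series_mult_den(2)[symmetric] by presburger
    then show ?L unfolding L poly_mapping_eq_iff by blast
  next
    assume ?L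
    then obtain c :: rat where c: "c = 1 \<or> c = - 1"
      and "\<And>e. Poly_Mapping.lookup ?B e = c * Poly_Mapping.lookup (?X * ?A) e"
      unfolding L by (elim disjE) (fastforce intro: that[of 1] that[of "- 1"])+
    then have "series_mult den ?G e = c * series_mult den (\<lambda>e. ?F (e - m)) e" for e
      unfolding shift series_mult_den(2) by simp
    then have 0: "series_mult den (\<lambda>e. ?G e - c * ?F (e - m)) = (\<lambda>_. 0)"
      by (simp add: fun_eq_iff series_mult_def right_diff_distrib sum_subtractf
            sum_distrib_left mult.left_commute)
    have ev: "\<forall>\<^sub>F k in sequentially. ?G (e - (\<Sum>i<k. w (v j)))
        - c * ?F (e - (\<Sum>i<k. w (v j)) - m) = 0" if "j < n" for j e
      using evG[OF that, of e] evF[OF that, of "e - m"]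
      by eventually_elim (simp add: cancel_ab_semigroup_add_class.diff_right_commute[of e m])
    have "(\<lambda>e. ?G e - c * ?F (e - m)) = (\<lambda>_. 0)"
      by (rule series_mult_den_eq_0[OF ev 0])
    then have eq: "?G e = c * ?F (e - m)" for e
      by (simp add: fun_eq_iff)
    \<comment> \<open>At exponent \<open>m\<close> a positive count times \<open>c\<close> equals a
      count, which rules out \<open>c = - 1\<close>.\<close>
    have "?F (m - m) > 0"
      using gen_series_cone_0_pos by simp
    moreover have "?G m \<ge> 0"
      by (simp add: gen_series_def)
    ultimately have "c = 1" using c eq[of m] by auto
    with eq show ?R by simp
  qed
qed

text \<open>The translate lies in the open cone, as a positive plus a nonnegative coordinate is
  positive. The fibres are finite, so in each degree the inclusion is an equality iff the
  cardinalities agree.\<close>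

lemma open_cone_eq_shift_iff:
  assumes c: "c \<in> open_cone"
  shows "open_cone = (+) c ` cone \<longleftrightarrow>
    (\<forall>e. gen_series w open_cone e = gen_series w cone (e - w c))"
proof -
  let ?S = "\<lambda>e. {x \<in> open_cone. w x = e}" and ?T = "\<lambda>e. {x \<in> cone. w x = e - w c}"
  have sub: "(+) c ` ?T e \<subseteq> ?S e" for e
    using c by (auto simp: cone_def open_cone_def coord_add w_add add_in intro!: add_pos_nonneg)
  have card: "card ((+) c ` ?T e) = card (?T e)" for e
    by (rule card_image) simp
  have fin: "finite (?S e)" for e
    by (rule finite_subset[OF _ finite_fibre[of e]]) (auto simp: open_cone_def less_imp_le)
  have "open_cone = (+) c ` cone \<longleftrightarrow> (\<forall>e. (+) c ` ?T e = ?S e)"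
  proof
    assume "open_cone = (+) c ` cone"
    then show "\<forall>e. (+) c ` ?T e = ?S e"
      by (auto simp: w_add)
  next
    assume *: "\<forall>e. (+) c ` ?T e = ?S e"
    have "x \<in> (+) c ` cone" if "x \<in> open_cone" for x
      using *[rule_format, of "w x"] that by blast
    moreover have "(+) c ` cone \<subseteq> open_cone"
      using c by (auto simp: cone_def open_cone_def coord_add add_in intro!: add_pos_nonneg)
    ultimately show "open_cone = (+) c ` cone" by blast
  qed
  moreover have "(+) c ` ?T e = ?S e \<longleftrightarrow> card (?S e) = card (?T e)" for e
  proof
    assume "(+) c ` ?T e = ?S e"
    then have "card ((+) c ` ?T e) = card (?S e)" by (rule arg_cong)
    then show "card (?S e) = card (?T e)" by (simp only: card)
  qed (simp only: card card_subset_eq[OF fin sub])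
  ultimately show ?thesis by (simp add: gen_series_def)
qed

lemma ex_open_cone_shift_iff:
  "(\<exists>c\<in>open_cone. w c = m \<and> open_cone = (+) c ` cone) \<longleftrightarrow>
   (\<exists>g. represents g (gen_series w cone) \<and>
        (invert_vars g = monomial m * g \<or> invert_vars g = - (monomial m * g)))"
  (is "?L \<longleftrightarrow> ?R")
proof
  assume ?L
  then show ?R
    unfolding functional_equation_iff using open_cone_eq_shift_iff by blast
next
  assume ?R
  then have eq: "\<forall>e. gen_series w open_cone e = gen_series w cone (e - m)"
    unfolding functional_equation_iff .
  \<comment> \<open>There are as many interior points of degree \<open>m\<close> as points of the
    closed cone of degree 0.\<close>
  have "gen_series w open_cone m > 0"
    using eq gen_series_cone_0_pos by simp
  then obtain c where "c \<in> open_cone" "w c = m"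
    by (auto simp: gen_series_def card_gt_0_iff)
  then show ?L using open_cone_eq_shift_iff eq by blast
qed

end

section \<open>The lecture hall cone\<close>

text \<open>The strict inequalities define an open set. Conversely, an interior point stays in the
  cone when pushed slightly in a direction that tightens all inequalities, so they were
  strict.\<close>

lemma interior_lecture_hall_cone:
  assumes s: "\<forall>i. s i > 0" and n: "n \<ge> 1"
  shows "Euclidean_space n interior_of lecture_hall_cone s n =
    {x \<in> topspace (Euclidean_space n). 0 < x 0 / real (s 0) \<and>
       (\<forall>i. Suc i < n \<longrightarrow> x i / real (s i) < x (Suc i) / real (s (Suc i)))}"
    (is "_ = ?U")
proof
  define V where "V = {x. 0 < x 0 / real (s 0)} \<inter>
    (\<Inter>i\<in>{i. Suc i < n}. {x. x i / real (s i) < x (Suc i) / real (s (Suc i))})"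
  have "finite {i. Suc i < n}"
    by (rule finite_subset[of _ "{..<n}"]) auto
  then have "open V"
    unfolding V_def using s
    by (intro open_Int open_INT ballI open_Collect_less continuous_intros
          continuous_on_product_coordinates) (auto simp: less_imp_neq[symmetric])
  moreover have "Euclidean_space n = top_of_set (topspace (Euclidean_space n))"
    by (simp add: Euclidean_space_def euclidean_product_topology)
  ultimately have "openin (Euclidean_space n) (topspace (Euclidean_space n) \<inter> V)"
    by (metis openin_open_Int)
  moreover have "topspace (Euclidean_space n) \<inter> V = ?U"
    by (auto simp: V_def)
  ultimately show "?U \<subseteq> Euclidean_space n interior_of lecture_hall_cone s n"
    by (intro interior_of_maximal) (auto simp: lecture_hall_cone_def less_imp_le)
next
  show "Euclidean_space n interior_of lecture_hall_cone s n \<subseteq> ?U"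
  proof
    fix x assume "x \<in> Euclidean_space n interior_of lecture_hall_cone s n"
    then obtain T where T: "openin (Euclidean_space n) T" "x \<in> T" "T \<subseteq> lecture_hall_cone s n"
      by (auto simp: interior_of_def)
    have x: "x \<in> topspace (Euclidean_space n)"
      using T openin_subset by blast
    \<comment> \<open>The ratio at \<open>i\<close> drops by \<open>t * (i + 1)\<close>, hence the
      first ratio and every difference of consecutive ratios drop by exactly
      \<open>t\<close>.\<close>
    define f where "f = (\<lambda>(t::real) i. if i < n then x i - t * (real (Suc i) * real (s i)) else 0)"
    have "continuous_map euclideanreal (Euclidean_space n) f"
      unfolding f_def continuous_map_componentwise_Euclidean_space
      by (auto intro!: continuous_intros)
    from openin_continuous_map_preimage[OF this T(1)] have "open {t. f t \<in> T}"
      by simp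
    moreover have "f 0 = x"
      using x by (auto simp: f_def topspace_Euclidean_space)
    ultimately obtain e where e: "e > 0" "\<And>t. dist t 0 < e \<Longrightarrow> f t \<in> T"
      using T(2) by (metis mem_Collect_eq open_dist)
    then have fC: "f (e / 2) \<in> lecture_hall_cone s n"
      using T(3) by (auto simp: subset_iff)
    have fd: "f (e / 2) i / real (s i) = x i / real (s i) - e / 2 * real (Suc i)" if "i < n" for i
      using that s[rule_format, of i] by (simp add: f_def field_simps)
    have "0 \<le> f (e / 2) 0 / real (s 0)"
      using fC by (auto simp: lecture_hall_cone_def)
    then have "0 < x 0 / real (s 0)"
      using fd[of 0] n e(1) by simp
    moreover have "x i / real (s i) < x (Suc i) / real (s (Suc i))" if "Suc i < n" for i
    proof -
      have "f (e / 2) i / real (s i) \<le> f (e / 2) (Suc i) / real (s (Suc i))"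
        using fC that by (auto simp: lecture_hall_cone_def)
      moreover have "e / 2 * real (Suc (Suc i)) = e / 2 * real (Suc i) + e / 2"
        by (simp add: field_simps)
      ultimately show ?thesis
        using fd[of i] fd[of "Suc i"] that e(1) by linarith
    qed
    ultimately show "x \<in> ?U" using x by blast
  qed
qed

section \<open>Lattice points in ray coordinates\<close>

definition real_point :: "(nat \<Rightarrow>\<^sub>0 int) \<Rightarrow> nat \<Rightarrow> real" where
  "real_point l i = real_of_int (Poly_Mapping.lookup l i)"

definition lattice :: "nat \<Rightarrow> (nat \<Rightarrow>\<^sub>0 int) set" where
  "lattice n = {l. \<forall>i\<ge>n. Poly_Mapping.lookup l i = 0}"

text \<open>Coordinates with respect to the ray generators \<open>(0, \<dots>, 0, s j, \<dots>, s (n - 1))\<close>.\<close>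

definition ray_coord :: "(nat \<Rightarrow> nat) \<Rightarrow> nat \<Rightarrow> (nat \<Rightarrow>\<^sub>0 int) \<Rightarrow> real" where
  "ray_coord s j l = real_point l j / real (s j) -
     (if j = 0 then 0 else real_point l (j - 1) / real (s (j - 1)))"

definition ray :: "(nat \<Rightarrow> nat) \<Rightarrow> nat \<Rightarrow> nat \<Rightarrow> nat \<Rightarrow>\<^sub>0 int" where
  "ray s n k = (\<Sum>i\<in>{k..<n}. Poly_Mapping.single i (int (s i)))"

lemma lookup_ray: "Poly_Mapping.lookup (ray s n k) i = (if k \<le> i \<and> i < n then int (s i) else 0)"
  by (auto simp: ray_def lookup_sum lookup_single when_def)

lemma inj_real_point: "inj real_point"
  by (rule injI) (metis of_int_eq_iff poly_mapping_eqI real_point_def)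

lemma real_point_in_topspace: "real_point l \<in> topspace (Euclidean_space n) \<longleftrightarrow> l \<in> lattice n"
  by (simp add: topspace_Euclidean_space lattice_def real_point_def)

lemma integer_points_eq: "integer_points n = real_point ` lattice n"
proof
  show "real_point ` lattice n \<subseteq> integer_points n"
    by (auto simp: integer_points_def topspace_Euclidean_space lattice_def real_point_def)
  show "integer_points n \<subseteq> real_point ` lattice n"
  proof
    fix x assume x: "x \<in> integer_points n"
    \<comment> \<open>The floor merely turns integral reals into integers.\<close>
    let ?l = "Abs_poly_mapping (\<lambda>i. \<lfloor>x i\<rfloor>)"
    have "finite {i. \<lfloor>x i\<rfloor> \<noteq> 0}"
      by (rule finite_subset[of _ "{..<n}"])
         (use x in \<open>auto simp: integer_points_def topspace_Euclidean_space not_less[symmetric]\<close>)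
    then have l: "Poly_Mapping.lookup ?l i = \<lfloor>x i\<rfloor>" for i
      by simp
    then have "real_point ?l = x"
      using x by (auto simp: fun_eq_iff real_point_def integer_points_def)
    moreover have "?l \<in> lattice n"
      using x l by (auto simp: lattice_def integer_points_def topspace_Euclidean_space)
    ultimately show "x \<in> real_point ` lattice n" by (metis imageI)
  qed
qed

lemma finite_bounded_lattice:
  "finite {l \<in> lattice n. \<forall>i<n. 0 \<le> Poly_Mapping.lookup l i \<and> Poly_Mapping.lookup l i \<le> N i}"
    (is "finite ?S")
proof -
  \<comment> \<open>The union serves as one finite set of values for all coordinates.\<close>
  have "finite {f :: nat \<Rightarrow> int. \<forall>i. (i \<in> {..<n} \<longrightarrow> f i \<in> (\<Union>i<n. {0..N i})) \<and> (i \<notin> {..<n} \<longrightarrow> f i = 0)}"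
    by (rule finite_set_of_finite_funs) auto
  then have "finite (Poly_Mapping.lookup ` ?S)"
    by (rule rev_finite_subset) (auto simp: lattice_def)
  moreover have "inj_on Poly_Mapping.lookup ?S"
    by (simp add: inj_on_def lookup_inject)
  ultimately show ?thesis by (rule finite_imageD)
qed

text \<open>The sum telescopes; it converts bounds on ray coordinates into bounds on
  entries.\<close>

lemma sum_ray_coord: "(\<Sum>j\<le>i. ray_coord s j l) = real_point l i / real (s i)"
  by (induction i) (simp_all add: ray_coord_def)

lemma lookup_nonneg_if_ray_coord_nonneg:
  assumes "\<forall>i. s i > 0" "\<forall>j<n. 0 \<le> ray_coord s j l" "i < n"
  shows "0 \<le> Poly_Mapping.lookup l i"
proof -
  have "0 \<le> real_point l i / real (s i)"
    unfolding sum_ray_coord[symmetric] by (rule sum_nonneg) (use assms in auto)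
  then show ?thesis
    using assms(1)[rule_format, of i] by (simp add: real_point_def zero_le_divide_iff)
qed

lemma simplicial_cone_lecture_hall:
  fixes w :: "(nat \<Rightarrow>\<^sub>0 int) \<Rightarrow> 'a::linordered_ab_group_add"
  assumes s: "\<forall>i. s i > 0"
    and w: "Modules.additive w" "\<And>j. j < n \<Longrightarrow> w (ray s n j) \<noteq> 0"
    and fib: "\<And>e. finite {l \<in> lattice n. (\<forall>j<n. 0 \<le> ray_coord s j l) \<and> w l = e}"
  shows "simplicial_cone (lattice n) n (ray_coord s) (ray s n) w"
proof
  show "finite {l \<in> lattice n. \<forall>j<n. 0 \<le> ray_coord s j l \<and> ray_coord s j l \<le> 1}"
  proof (rule finite_subset[OF _ finite_bounded_lattice])
    \<comment> \<open>Entry \<open>i\<close> divided by \<open>s i\<close> is a sum of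
      \<open>i + 1\<close> ray coordinates, each at most 1.\<close>
    have "Poly_Mapping.lookup l i \<le> int (Suc i * s i)"
      if "\<forall>j<n. 0 \<le> ray_coord s j l \<and> ray_coord s j l \<le> 1" "i < n" for l i
    proof -
      have "real_point l i / real (s i) \<le> (\<Sum>j\<le>i. 1)"
        unfolding sum_ray_coord[symmetric] by (rule sum_mono) (use that in auto)
      then have "real_point l i \<le> real_of_int (int (Suc i * s i))"
        using s[rule_format, of i] by (simp add: field_simps)
      then show ?thesis unfolding real_point_def by linarith
    qed
    then show "{l \<in> lattice n. \<forall>j<n. 0 \<le> ray_coord s j l \<and> ray_coord s j l \<le> 1} \<subseteq>
      {l \<in> lattice n. \<forall>i<n. 0 \<le> Poly_Mapping.lookup l i \<and>
         Poly_Mapping.lookup l i \<le> int (Suc i * s i)}"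
      using lookup_nonneg_if_ray_coord_nonneg[OF s, of n] by (intro Collect_mono) simp
  qed
  have [simp]: "s i \<noteq> 0" for i
    using s by (metis less_irrefl)
  show "ray_coord s j (ray s n k) = (if j = k then 1 else 0)" if "j < n" "k < n" for j k
    using that by (cases j) (auto simp: ray_coord_def real_point_def lookup_ray le_Suc_eq)
  show "ray_coord s j (x + y) = ray_coord s j x + ray_coord s j y" for j x y
    by (simp add: ray_coord_def real_point_def lookup_add add_divide_distrib)
qed (use w fib in \<open>auto simp: lattice_def lookup_minus lookup_ray Modules.additive.add\<close>)

section \<open>The trivial grading and the grading by weight\<close>

context
  fixes s :: "nat \<Rightarrow> nat" and n :: nat
  assumes s: "\<forall>i. s i > 0" and n: "n \<ge> 1"
begin

text \<open>Matches the ray coordinates with the cone inequalities: coordinate 0 is the first ratio,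
  the others are differences of consecutive ratios.\<close>

lemma all_less_split:
  "(\<forall>j<n. P j) \<longleftrightarrow> P 0 \<and> (\<forall>i. Suc i < n \<longrightarrow> P (Suc i))"
  using n by (metis (no_types) less_eq_Suc_le One_nat_def not0_implies_Suc)

interpretation id: simplicial_cone "lattice n" n "ray_coord s" "ray s n" "\<lambda>l. l"
proof (rule simplicial_cone_lecture_hall[OF s])
  show "ray s n j \<noteq> 0" if "j < n" for j
    using that s lookup_ray[of s n j j] by (metis le_refl lookup_zero of_nat_0_eq_iff less_irrefl)
  show "finite {l \<in> lattice n. (\<forall>j<n. 0 \<le> ray_coord s j l) \<and> l = e}" for e
    by (rule finite_subset[of _ "{e}"]) auto
qed (simp add: Modules.additive_def)

text \<open>Entries of cone points are nonnegative, so each is at most the weight; this bounds the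
  fibres.\<close>

interpretation wt: simplicial_cone "lattice n" n "ray_coord s" "ray s n" "weight n"
proof (rule simplicial_cone_lecture_hall[OF s])
  show "weight n (ray s n j) \<noteq> 0" if "j < n" for j
  proof -
    have "0 < weight n (ray s n j)"
      unfolding weight_def
      by (rule sum_pos2[of _ j]) (use that s in \<open>auto simp: lookup_ray\<close>)
    then show ?thesis by simp
  qed
  show "finite {l \<in> lattice n. (\<forall>j<n. 0 \<le> ray_coord s j l) \<and> weight n l = e}" for e
  proof (rule finite_subset[OF _ finite_bounded_lattice])
    show "{l \<in> lattice n. (\<forall>j<n. 0 \<le> ray_coord s j l) \<and> weight n l = e} \<subseteq>
      {l \<in> lattice n. \<forall>i<n. 0 \<le> Poly_Mapping.lookup l i \<and> Poly_Mapping.lookup l i \<le> e}"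
      using lookup_nonneg_if_ray_coord_nonneg[OF s] by (auto simp: weight_def intro!: member_le_sum)
  qed
qed (simp add: Modules.additive_def weight_def lookup_add sum.distrib)

lemma real_point_in_cone: "real_point l \<in> lecture_hall_cone s n \<longleftrightarrow> l \<in> id.cone"
  by (simp add: lecture_hall_cone_def id.cone_def real_point_in_topspace all_less_split
        ray_coord_def)

lemma cone_eq: "id.cone = lecture_hall_partitions s n"
  unfolding set_eq_iff real_point_in_cone[symmetric]
  by (simp add: lecture_hall_partitions_def real_point_def[abs_def])

lemma real_point_cone:
  "lecture_hall_cone s n \<inter> integer_points n = real_point ` id.cone"
proof -
  have "id.cone \<subseteq> lattice n"
    by (auto simp: id.cone_def)
  then show ?thesis
    unfolding integer_points_eq using real_point_in_cone by blast
qed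

lemma real_point_open_cone:
  "(Euclidean_space n interior_of lecture_hall_cone s n) \<inter> integer_points n
     = real_point ` id.open_cone"
proof -
  have "real_point l \<in> Euclidean_space n interior_of lecture_hall_cone s n \<longleftrightarrow> l \<in> id.open_cone" for l
    unfolding interior_lecture_hall_cone[OF s n]
    by (simp add: id.open_cone_def real_point_in_topspace all_less_split ray_coord_def)
  moreover have "id.open_cone \<subseteq> lattice n"
    by (auto simp: id.open_cone_def)
  ultimately show ?thesis
    unfolding integer_points_eq by blast
qed

lemma gorenstein_iff:
  "gorenstein_cone n (lecture_hall_cone s n) \<longleftrightarrow>
    (\<exists>c\<in>id.open_cone. id.open_cone = (+) c ` id.cone)"
proof -
  have "(\<lambda>x i. real_point c i + x i) ` real_point ` A = real_point ` (+) c ` A" for c A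
    by (simp add: image_image real_point_def[abs_def] lookup_add)
  then show ?thesis
    unfolding gorenstein_cone_def real_point_cone real_point_open_cone
    by (simp add: inj_image_eq_iff[OF inj_real_point])
qed

text \<open>For the trivial grading \<open>m\<close> is the Gorenstein point \<open>c\<close>
  itself, which lies in the closed cone.\<close>

lemma multivariate_iff:
  "(\<exists>m \<in> lecture_hall_partitions s n.
         \<exists>g. represents g (gen_series (\<lambda>l. l) (lecture_hall_partitions s n)) \<and>
             (invert_vars g = monomial m * g \<or> invert_vars g = - (monomial m * g)))
   \<longleftrightarrow> (\<exists>c\<in>id.open_cone. id.open_cone = (+) c ` id.cone)"
proof -
  have "id.open_cone \<subseteq> id.cone"
    by (auto simp: id.open_cone_def id.cone_def less_imp_le)
  then show ?thesis
    unfolding cone_eq[symmetric] id.ex_open_cone_shift_iff[symmetric] by blast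
qed

text \<open>Interior points have nonnegative weight, so the natural exponents of
  \<open>self_reciprocal\<close> reach every \<open>c\<close>.\<close>

lemma univariate_iff:
  "(\<exists>f. represents f (gen_series (weight n) (lecture_hall_partitions s n)) \<and> self_reciprocal f)
   \<longleftrightarrow> (\<exists>c\<in>id.open_cone. id.open_cone = (+) c ` id.cone)"
proof -
  have "0 \<le> weight n c" if "c \<in> id.open_cone" for c
    unfolding weight_def
    by (rule sum_nonneg) (use that lookup_nonneg_if_ray_coord_nonneg[OF s, of n c] in \<open>auto simp: id.open_cone_def less_imp_le\<close>)
  then have "(\<exists>c\<in>id.open_cone. id.open_cone = (+) c ` id.cone) \<longleftrightarrow>
      (\<exists>k::nat. \<exists>c\<in>id.open_cone. weight n c = int k \<and> id.open_cone = (+) c ` id.cone)"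
    by (metis nonneg_int_cases)
  \<comment> \<open>The cones do not depend on the grading, so both interpretations speak of the
    same sets.\<close>
  also have "\<dots> \<longleftrightarrow> (\<exists>f. represents f (gen_series (weight n) id.cone) \<and> self_reciprocal f)"
    unfolding wt.ex_open_cone_shift_iff self_reciprocal_def by blast
  finally show ?thesis unfolding cone_eq ..
qed

end

theorem theorem1p5:
  fixes s :: "nat \<Rightarrow> nat" and n :: nat
  assumes "\<forall>i. s i > 0" and "n \<ge> 1"
  shows
    "(gorenstein_cone n (lecture_hall_cone s n) \<longleftrightarrow>
      (\<exists>m \<in> lecture_hall_partitions s n.
         \<exists>g. represents g (gen_series (\<lambda>l. l) (lecture_hall_partitions s n)) \<and>
             (invert_vars g = monomial m * g \<or> invert_vars g = - (monomial m * g))))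
     \<and>
     ((\<exists>m \<in> lecture_hall_partitions s n.
         \<exists>g. represents g (gen_series (\<lambda>l. l) (lecture_hall_partitions s n)) \<and>
             (invert_vars g = monomial m * g \<or> invert_vars g = - (monomial m * g)))
      \<longleftrightarrow>
      (\<exists>f. represents f (gen_series (weight n) (lecture_hall_partitions s n)) \<and>
           self_reciprocal f))"
  unfolding gorenstein_iff[OF assms] multivariate_iff[OF assms] univariate_iff[OF assms]
  by (intro conjI refl)

end
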